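(* Let $(F_4)^{\sigma}=\{\alpha\in F_4 \mid \sigma\alpha\sigma=\alpha\}$ and $(F_4)^{\sigma'}=\{\alpha\in F_4\mid \sigma'\alpha\sigma'=\alpha\}$. Then $$(F_4)^{\sigma}\cap (F_4)^{\sigma'}\;\cong\;Spin(8).$$
   Context: Let $\mathfrak{C}$ be the division Cayley algebra (octonions) and $\mathfrak{J}=\{X\in M(3,\mathfrak{C})\mid X^*=X\}$ the exceptional Jordan algebra with product $X\circ Y=\frac12(XY+YX)$; write $$X=\begin{pmatrix}\xi_1&x_3&\overline{x}_2\\ \overline{x}_3&\xi_2&x_1\\ x_2&\overline{x}_1&\xi_3\end{pmatrix},\quad \xi_k\in\mathbf{R},\ x_k\in\mathfrak{C}.$$ $F_4=\{\alpha\in\mathrm{Iso}_{\mathbf R}(\mathfrak{J})\mid \alpha(X\circ Y)=\alpha X\circ\alpha Y\}$. The involutive elements $\sigma,\sigma'\in F_4$ keep all $\xi_k$; $\sigma$ maps $(x_1,x_2,x_3)\mapsto(x_1,-x_2,-x_3)$ and $\sigma'$ maps $(x_1,x_2,x_3)\mapsto(-x_1,-x_2,x_3)$. The group $Spin(8)$ is realized as $\{(\alpha_1,\alpha_2,\alpha_3)\in SO(8)\times SO(8)\times SO(8)\mid (\alpha_1x)(\alpha_2y)=\overline{\alpha_3(\overline{xy})}\ \text{for all } x,y\in\mathfrak{C}\}$, where $SO(8)$ acts on $\mathfrak{C}=\mathbf{R}^8$. *)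

theory Defs
  imports "HOL-Analysis.Analysis" "HOL-Algebra.Bij"
begin

section \<open>The division Cayley algebra\<close>

text \<open>
  Coordinates are indexed by \<open>0, \<dots>, 7\<close> (an element of type \<open>8\<close> is an integer modulo 8, so
  \<open>x $ 0\<close> and \<open>x $ 8\<close> are the same coordinate); \<open>x\<close> stands for \<open>\<Sum>i. x $ i e\<^sub>i\<close> with unit \<open>e\<^sub>0 = 1\<close>.
\<close>

type_synonym cayley = "real ^ 8"

definition cconj :: "cayley \<Rightarrow> cayley" where
  "cconj x = (\<chi> k. if k = 0 then x $ 0 else - x $ k)"

definition creal :: "real \<Rightarrow> cayley" where
  "creal r = axis 0 r"

text \<open>
  The imaginary units satisfy \<open>e\<^sub>i\<^sup>2 = -1\<close>, anticommute, and multiply along the seven oriented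
  Fano lines \<open>(e\<^sub>i, e\<^sub>i\<^sub>+\<^sub>1, e\<^sub>i\<^sub>+\<^sub>3)\<close>, indices modulo 7: \<open>a b = c\<close>, \<open>b c = a\<close>, \<open>c a = b\<close> on each
  line \<open>(a, b, c)\<close>.
\<close>

definition cmul :: "cayley \<Rightarrow> cayley \<Rightarrow> cayley" (infixl \<open>\<odot>\<close> 70) where
  "x \<odot> y =
    (let b = (\<lambda>i j. x $ i * y $ j - x $ j * y $ i) in
     \<chi> k. if k = 0 then x $ 0 * y $ 0 - (\<Sum>i\<in>UNIV - {0}. x $ i * y $ i)
          else x $ 0 * y $ k + x $ k * y $ 0 +
           (if k = 1 then b 2 4 + b 3 7 + b 5 6
            else if k = 2 then b 3 5 + b 4 1 + b 6 7
            else if k = 3 then b 4 6 + b 5 2 + b 7 1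
            else if k = 4 then b 5 7 + b 6 3 + b 1 2
            else if k = 5 then b 6 1 + b 7 4 + b 2 3
            else if k = 6 then b 7 2 + b 1 5 + b 3 4
            else b 1 3 + b 2 6 + b 4 5))"

lemma exhaust_8:
  fixes x :: 8
  shows "x = 0 \<or> x = 1 \<or> x = 2 \<or> x = 3 \<or> x = 4 \<or> x = 5 \<or> x = 6 \<or> x = 7"
proof (induct x)
  case (of_int z)
  then have "z = 0 \<or> z = 1 \<or> z = 2 \<or> z = 3 \<or> z = 4 \<or> z = 5 \<or> z = 6 \<or> z = 7" by fastforce
  then show ?case by auto
qed

lemma UNIV_8: "(UNIV :: 8 set) = {0, 1, 2, 3, 4, 5, 6, 7}"
  using exhaust_8 by auto

lemma forall_8: "(\<forall>i::8. P i) \<longleftrightarrow> P 0 \<and> P 1 \<and> P 2 \<and> P 3 \<and> P 4 \<and> P 5 \<and> P 6 \<and> P 7"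
  by (metis exhaust_8)

lemma sum_8: "sum f (UNIV :: 8 set) = f 0 + f 1 + f 2 + f 3 + f 4 + f 5 + f 6 + f 7"
  unfolding UNIV_8 by (simp add: ac_simps)

lemma cmul_nth:
  "(x \<odot> y) $ 0 = x$0 * y$0 - x$1 * y$1 - x$2 * y$2 - x$3 * y$3
                - x$4 * y$4 - x$5 * y$5 - x$6 * y$6 - x$7 * y$7"
  "(x \<odot> y) $ 1 = x$0 * y$1 + x$1 * y$0 + (x$2 * y$4 - x$4 * y$2)
                + (x$3 * y$7 - x$7 * y$3) + (x$5 * y$6 - x$6 * y$5)"
  "(x \<odot> y) $ 2 = x$0 * y$2 + x$2 * y$0 + (x$3 * y$5 - x$5 * y$3)
                + (x$4 * y$1 - x$1 * y$4) + (x$6 * y$7 - x$7 * y$6)"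
  "(x \<odot> y) $ 3 = x$0 * y$3 + x$3 * y$0 + (x$4 * y$6 - x$6 * y$4)
                + (x$5 * y$2 - x$2 * y$5) + (x$7 * y$1 - x$1 * y$7)"
  "(x \<odot> y) $ 4 = x$0 * y$4 + x$4 * y$0 + (x$5 * y$7 - x$7 * y$5)
                + (x$6 * y$3 - x$3 * y$6) + (x$1 * y$2 - x$2 * y$1)"
  "(x \<odot> y) $ 5 = x$0 * y$5 + x$5 * y$0 + (x$6 * y$1 - x$1 * y$6)
                + (x$7 * y$4 - x$4 * y$7) + (x$2 * y$3 - x$3 * y$2)"
  "(x \<odot> y) $ 6 = x$0 * y$6 + x$6 * y$0 + (x$7 * y$2 - x$2 * y$7)
                + (x$1 * y$5 - x$5 * y$1) + (x$3 * y$4 - x$4 * y$3)"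
  "(x \<odot> y) $ 7 = x$0 * y$7 + x$7 * y$0 + (x$1 * y$3 - x$3 * y$1)
                + (x$2 * y$6 - x$6 * y$2) + (x$4 * y$5 - x$5 * y$4)"
proof -
  have "UNIV - {0} = {1, 2, 3, 4, 5, 6, 7 :: 8}"
    unfolding UNIV_8 by auto
  then have "(\<Sum>i\<in>UNIV - {0}. x $ i * y $ i) = x$1 * y$1 + x$2 * y$2 + x$3 * y$3
      + x$4 * y$4 + x$5 * y$5 + x$6 * y$6 + x$7 * y$7"
    by simp
  then show "(x \<odot> y) $ 0 = x$0 * y$0 - x$1 * y$1 - x$2 * y$2 - x$3 * y$3
                - x$4 * y$4 - x$5 * y$5 - x$6 * y$6 - x$7 * y$7"
    by (simp add: cmul_def Let_def)
qed (simp_all add: cmul_def Let_def)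

lemma cmul_creal: "creal r \<odot> x = r *\<^sub>R x" "x \<odot> creal r = r *\<^sub>R x"
  by (simp_all add: vec_eq_iff forall_8 cmul_nth creal_def axis_def)

lemma cmul_cconj: "x \<odot> cconj x = creal ((norm x)\<^sup>2)"
  by (simp add: vec_eq_iff forall_8 cmul_nth cconj_def creal_def axis_def
      power2_norm_eq_inner inner_vec_def sum_8)

lemma norm_cmul: "norm (x \<odot> y) = norm x * norm y"
 proof -
  have "(norm (x \<odot> y))\<^sup>2 = (norm x)\<^sup>2 * (norm y)\<^sup>2"
    unfolding power2_norm_eq_inner inner_vec_def sum_8 cmul_nth inner_real_def
    by (simp only: ring_distribs) (simp add: ac_simps)
  then show ?thesis
    by (metis norm_ge_zero mult_nonneg_nonneg power2_eq_imp_eq power_mult_distrib)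
qed

section \<open>The exceptional Jordan algebra\<close>

type_synonym cayley_mat3 = "cayley ^ 3 ^ 3"

definition mmul :: "cayley_mat3 \<Rightarrow> cayley_mat3 \<Rightarrow> cayley_mat3" where
  "mmul X Y = (\<chi> i j. \<Sum>k\<in>UNIV. X $ i $ k \<odot> Y $ k $ j)"

definition adj :: "cayley_mat3 \<Rightarrow> cayley_mat3" where
  "adj X = (\<chi> i j. cconj (X $ j $ i))"

definition jordan :: "cayley_mat3 set" (\<open>\<JJ>\<close>) where
  "\<JJ> = {X. adj X = X}"

definition jmul :: "cayley_mat3 \<Rightarrow> cayley_mat3 \<Rightarrow> cayley_mat3" (infixl \<open>\<circ>\<^sub>J\<close> 70) where
  "X \<circ>\<^sub>J Y = (1 / 2) *\<^sub>R (mmul X Y + mmul Y X)"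

definition jmat :: "real \<Rightarrow> real \<Rightarrow> real \<Rightarrow> cayley \<Rightarrow> cayley \<Rightarrow> cayley \<Rightarrow> cayley_mat3" where
  "jmat \<xi>\<^sub>1 \<xi>\<^sub>2 \<xi>\<^sub>3 x\<^sub>1 x\<^sub>2 x\<^sub>3 =
    vector [vector [creal \<xi>\<^sub>1, x\<^sub>3,        cconj x\<^sub>2],
            vector [cconj x\<^sub>3, creal \<xi>\<^sub>2, x\<^sub>1      ],
            vector [x\<^sub>2,       cconj x\<^sub>1, creal \<xi>\<^sub>3]]"

lemma jmat_nth:
  "jmat a b c x y z $ 1 $ 1 = creal a" "jmat a b c x y z $ 1 $ 2 = z"
  "jmat a b c x y z $ 1 $ 3 = cconj y" "jmat a b c x y z $ 2 $ 1 = cconj z"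
  "jmat a b c x y z $ 2 $ 2 = creal b" "jmat a b c x y z $ 2 $ 3 = x"
  "jmat a b c x y z $ 3 $ 1 = y" "jmat a b c x y z $ 3 $ 2 = cconj x"
  "jmat a b c x y z $ 3 $ 3 = creal c"
  by (simp_all add: jmat_def)

lemma jmat_in_jordan: "jmat a b c x y z \<in> \<JJ>"
  by (simp add: jordan_def adj_def vec_eq_iff forall_3 forall_8 jmat_nth cconj_def creal_def axis_def)

lemma jordan_eq_jmat:
  assumes "X \<in> \<JJ>"
  shows "X = jmat (X $ 1 $ 1 $ 0) (X $ 2 $ 2 $ 0) (X $ 3 $ 3 $ 0) (X $ 2 $ 3) (X $ 3 $ 1) (X $ 1 $ 2)"
  using assms
  proof -
  have h: "X $ i $ j = cconj (X $ j $ i)" for i j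
    using assms by (simp add: jordan_def adj_def vec_eq_iff)
  have d: "X $ i $ i = creal (X $ i $ i $ 0)" for i
    using h[of i i] unfolding vec_eq_iff forall_8
    by (simp add: cconj_def creal_def axis_def)
  show ?thesis
    unfolding vec_eq_iff[of X] vec_eq_iff[of "X $ _"] forall_3 jmat_nth
    using d h by blast
qed

section \<open>The group \<open>F\<^sub>4\<close> and its involutions\<close>

text \<open>
  A transformation of \<open>\<JJ>\<close> is an element of \<^term>\<open>BijGroup \<JJ>\<close>, i.e. a function on all matrices that
  is undefined outside \<open>\<JJ>\<close>.
\<close>

definition F4 :: "(cayley_mat3 \<Rightarrow> cayley_mat3) monoid" where
  "F4 = (BijGroup \<JJ>)\<lparr>carrier := {\<alpha> \<in> Bij \<JJ>.
      (\<forall>X\<in>\<JJ>. \<forall>Y\<in>\<JJ>. \<alpha> (X + Y) = \<alpha> X + \<alpha> Y) \<and>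
      (\<forall>c::real. \<forall>X\<in>\<JJ>. \<alpha> (c *\<^sub>R X) = c *\<^sub>R \<alpha> X) \<and>
      (\<forall>X\<in>\<JJ>. \<forall>Y\<in>\<JJ>. \<alpha> (X \<circ>\<^sub>J Y) = \<alpha> X \<circ>\<^sub>J \<alpha> Y)}\<rparr>"

definition sigma :: "cayley_mat3 \<Rightarrow> cayley_mat3" (\<open>\<sigma>\<close>) where
  "\<sigma> = (\<lambda>X\<in>\<JJ>. jmat (X $ 1 $ 1 $ 0) (X $ 2 $ 2 $ 0) (X $ 3 $ 3 $ 0)
                     (X $ 2 $ 3) (- X $ 3 $ 1) (- X $ 1 $ 2))"

definition sigma' :: "cayley_mat3 \<Rightarrow> cayley_mat3" (\<open>\<sigma>''\<close>) where
  "\<sigma>' = (\<lambda>X\<in>\<JJ>. jmat (X $ 1 $ 1 $ 0) (X $ 2 $ 2 $ 0) (X $ 3 $ 3 $ 0)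
                      (- X $ 2 $ 3) (- X $ 3 $ 1) (X $ 1 $ 2))"

definition F4_fix :: "(cayley_mat3 \<Rightarrow> cayley_mat3) \<Rightarrow> (cayley_mat3 \<Rightarrow> cayley_mat3) set" where
  "F4_fix s = {\<alpha> \<in> carrier F4. s \<otimes>\<^bsub>F4\<^esub> \<alpha> \<otimes>\<^bsub>F4\<^esub> s = \<alpha>}"

section \<open>The group \<open>Spin(8)\<close>\<close>

definition SO8 :: "(real ^ 8 ^ 8) monoid" where
  "SO8 = \<lparr>carrier = {A. rotation_matrix A}, mult = (**), one = mat 1\<rparr>"

definition Spin8 :: "((real ^ 8 ^ 8) \<times> (real ^ 8 ^ 8) \<times> (real ^ 8 ^ 8)) monoid" where
  "Spin8 = (SO8 \<times>\<times> SO8 \<times>\<times> SO8)\<lparr>carrier :=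
     {(A\<^sub>1, A\<^sub>2, A\<^sub>3) \<in> carrier (SO8 \<times>\<times> SO8 \<times>\<times> SO8).
        \<forall>x y :: cayley. (A\<^sub>1 *v x) \<odot> (A\<^sub>2 *v y) = cconj (A\<^sub>3 *v cconj (x \<odot> y))}\<rparr>"

section \<open>Isomorphism of topological groups\<close>

text \<open>
  The topology on each carrier is the subspace topology of its ambient type.  For matrices this is
  the usual one.  For functions it is the product topology, i.e. pointwise convergence; on linear
  maps of the finite-dimensional space \<open>\<JJ>\<close> (all with the same value \<^term>\<open>undefined\<close> outside \<open>\<JJ>\<close>)
  this is again the usual one.
\<close>

definition topgroup_iso ::
  "('a::topological_space, 'c) monoid_scheme \<Rightarrow> ('b::topological_space, 'd) monoid_scheme \<Rightarrow> bool"
  (infix \<open>\<cong>\<^sub>t\<close> 60) where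
  "G \<cong>\<^sub>t H \<longleftrightarrow> (\<exists>\<phi>\<in>iso G H.
     homeomorphic_map (top_of_set (carrier G)) (top_of_set (carrier H)) \<phi>)"

end

theory Submission
  imports Defs
begin

text \<open>
  An \<open>\<alpha>\<close> that commutes with both involutions preserves the diagonal and each of the three off-diagonal
  spaces. The Jordan product then forces it to fix the diagonal and to act on the off-diagonal
  entries by isometries in triality; conversely triality is invariant under cyclic rotation, because
  the trilinear form \<open>(x, y, z) \<mapsto> Re ((x y) z)\<close> is, so every such triple respects the Jordan product.

  It remains to see that orthogonal maps in triality have determinant 1. For \<open>a \<noteq> 0\<close> the map
  \<open>x \<mapsto> reflection a (cconj x)\<close> is a component of a triple, by the identity
  \<open>reflection a (cconj x) \<odot> (cconj a \<odot> y) = - (a \<odot> (x \<odot> y))\<close>. Hence if \<open>f\<close> is a product of \<open>n\<close> reflections,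
  then \<open>f \<circ> cconj\<^sup>n\<close> is a component of a triple; if \<open>f\<close> were one for odd \<open>n\<close>, then so would be \<open>cconj\<close>,
  which is impossible.
\<close>

section \<open>Reflections\<close>

definition reflection :: "'a::real_inner \<Rightarrow> 'a \<Rightarrow> 'a" where
  "reflection a x = x - (2 * (a \<bullet> x) / (a \<bullet> a)) *\<^sub>R a"

lemma orthogonal_transformation_reflection: "orthogonal_transformation (reflection a)"
proof -
  have "linear (reflection a)"
    by (rule linearI)
      (simp_all add: reflection_def inner_add_right add_divide_distrib algebra_simps)
  moreover have "reflection a v \<bullet> reflection a w = v \<bullet> w" for v w
    by (cases "a = 0")
      (simp_all add: reflection_def inner_diff_left inner_diff_right inner_commute field_simps)
  ultimately show ?thesis
    by (simp add: orthogonal_transformation_def)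
qed

lemma reflection_orthogonal: "a \<bullet> x = 0 \<Longrightarrow> reflection a x = x"
  by (simp add: reflection_def)

lemma reflection_diff_eq:
  assumes "norm x = norm y" "x \<noteq> y"
  shows "reflection (x - y) x = y"
proof -
  have "x \<bullet> x = y \<bullet> y"
    using assms(1) by (metis norm_eq)
  then have "2 * ((x - y) \<bullet> x) = (x - y) \<bullet> (x - y)"
    by (simp add: inner_diff_left inner_diff_right inner_commute)
  then show ?thesis
    using assms(2) by (simp add: reflection_def)
qed

lemma reflection_reflection: "reflection a (reflection a x) = x"
  by (cases "a = 0") (simp_all add: reflection_def inner_diff_right)

text \<open>Conjugating by an orthogonal map reduces to a vector along a coordinate axis, where the
  matrix is diagonal with a single entry -1.\<close>

lemma det_reflection:
  fixes a :: "real ^ 'n"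
  assumes "a \<noteq> 0"
  shows "det (matrix (reflection a)) = -1"
proof -
  fix k :: 'n
  let ?e = "axis k 1 :: real ^ 'n"
  obtain g where g: "orthogonal_transformation g" "g (norm a *\<^sub>R ?e) = a"
    using orthogonal_transformation_exists[of "norm a *\<^sub>R ?e" a] by auto
  let ?b = "norm a *\<^sub>R ?e"
  have lin: "linear g" "linear (reflection a)" "linear (reflection ?b)"
    using g(1) orthogonal_transformation_reflection orthogonal_transformation_linear by blast+
  have inner_g: "a \<bullet> g x = ?b \<bullet> x" "a \<bullet> a = ?b \<bullet> ?b" for x
    using g by (metis orthogonal_transformation_def)+
  \<comment> \<open>\<open>g\<close> sends \<open>?b\<close> to \<open>a\<close> and preserves inner
    products, so it intertwines the two reflections.\<close>
  have "reflection a (g x) = g (reflection ?b x)" for x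
    unfolding reflection_def inner_g linear_diff[OF lin(1)]
      orthogonal_transformation_scaleR[OF g(1)] g(2)[unfolded orthogonal_transformation_scaleR[OF g(1)]]
    by simp
  then have "matrix (reflection a) ** matrix g = matrix g ** matrix (reflection ?b)"
    using lin by (simp add: matrix_compose[symmetric] o_def)
  then have "det (matrix (reflection a)) * det (matrix g) = det (matrix g) * det (matrix (reflection ?b))"
    by (metis det_mul)
  moreover have "det (matrix g) \<noteq> 0"
    using orthogonal_transformation_det[OF g(1)] by auto
  moreover have "det (matrix (reflection ?b)) = -1"
  proof -
    have "reflection ?b x = x - (2 * x $ k) *\<^sub>R ?e" for x
      using assms by (simp add: reflection_def inner_axis' inner_axis_axis)
    then have entry: "matrix (reflection ?b) $ i $ j = (if i = j then if i = k then -1 else 1 else 0)" for i j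
      by (auto simp: matrix_def axis_def)
    show ?thesis
      by (subst det_diagonal) (simp_all add: entry)
  qed
  ultimately show ?thesis
    by (metis mult.commute mult_cancel_left mult_minus1)
qed

text \<open>
  This is the Cartan--Dieudonne theorem. If \<open>f v \<noteq> v\<close>, then reflecting along \<open>f v - v\<close> fixes \<open>v\<close>
  and everything that \<open>f\<close> fixes, so the dimension of the space of fixed points grows.
\<close>

lemma orthogonal_transformation_induct [consumes 1, case_names id reflection]:
  fixes f :: "'a::euclidean_space \<Rightarrow> 'a"
  assumes f: "orthogonal_transformation f"
    and id: "P (\<lambda>x. x)"
    and step: "\<And>a f. a \<noteq> 0 \<Longrightarrow> orthogonal_transformation f \<Longrightarrow> P f \<Longrightarrow> P (\<lambda>x. reflection a (f x))"
  shows "P f"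
  using f
proof (induction "DIM('a) - dim {x. f x = x}" arbitrary: f rule: less_induct)
  case less
  show ?case
  proof (cases "\<forall>v. f v = v")
    case True
    then have "f = (\<lambda>x. x)" by auto
    then show ?thesis using id by simp
  next
    case False
    then obtain v where v: "f v \<noteq> v" by auto
    define a where "a = f v - v"
    define g where "g = (\<lambda>x. reflection a (f x))"
    have a: "a \<noteq> 0" using v by (simp add: a_def)
    have g: "orthogonal_transformation g"
      using orthogonal_transformation_compose[OF orthogonal_transformation_reflection less.prems, of a]
      by (simp add: g_def o_def)
    have "g x = x" if "f x = x" for x
    proof -
      have "f v \<bullet> x = v \<bullet> x"
        using less.prems that by (metis orthogonal_transformation_def)
      then show ?thesis
        using that by (simp add: g_def a_def reflection_orthogonal inner_diff_left)
    qed
    moreover have "g v = v"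
      using v reflection_diff_eq[of "f v" v] orthogonal_transformation_norm[OF less.prems]
      by (simp add: g_def a_def)
    ultimately have sub: "{x. f x = x} \<subset> {x. g x = x}"
      using v by blast
    \<comment> \<open>Strict growth of dimension needs strict inclusion of spans; fixed-point sets,
      being subspaces, are their own spans.\<close>
    have "subspace {x. h x = x}" if "orthogonal_transformation h" for h :: "'a \<Rightarrow> 'a"
      using orthogonal_transformation_linear[OF that]
      by (auto simp: subspace_def linear_add linear_0 linear_cmul)
    then have "dim {x. f x = x} < dim {x. g x = x}"
      using sub g less.prems by (intro dim_psubset) (simp add: span_eq_iff[THEN iffD2])
    moreover have "dim {x. g x = x} \<le> DIM('a)"
      by (rule dim_subset_UNIV)
    ultimately have "P g"
      using less.hyps[of g] g by simp
    moreover have "f = (\<lambda>x. reflection a (g x))"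
      by (simp add: g_def reflection_reflection)
    ultimately show ?thesis
      using step[OF a g] by simp
  qed
qed

section \<open>Identities in the Cayley algebra\<close>

lemma cmul_add: "x \<odot> (y + z) = x \<odot> y + x \<odot> z" "(x + y) \<odot> z = x \<odot> z + y \<odot> z"
  by (simp_all add: vec_eq_iff forall_8 cmul_nth algebra_simps)

lemma cmul_diff_left: "(x - y) \<odot> z = x \<odot> z - y \<odot> z"
  by (simp add: vec_eq_iff forall_8 cmul_nth algebra_simps)

lemma cmul_scaleR: "(r *\<^sub>R x) \<odot> y = r *\<^sub>R (x \<odot> y)" "x \<odot> (r *\<^sub>R y) = r *\<^sub>R (x \<odot> y)"
  by (simp_all add: vec_eq_iff forall_8 cmul_nth algebra_simps)

lemma cmul_zero [simp]: "0 \<odot> x = 0" "x \<odot> 0 = 0"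
  by (simp_all add: vec_eq_iff forall_8 cmul_nth)

lemma cmul_eq_0_iff: "x \<odot> y = 0 \<longleftrightarrow> x = 0 \<or> y = 0"
  by (metis norm_cmul mult_eq_0_iff norm_eq_zero)

lemma cmul_one: "creal 1 \<odot> x = x" "x \<odot> creal 1 = x"
  by (simp_all add: cmul_creal)

lemma cconj_cconj [simp]: "cconj (cconj x) = x"
  by (simp add: vec_eq_iff cconj_def)

lemma cconj_zero [simp]: "cconj 0 = 0"
  by (simp add: vec_eq_iff cconj_def)

lemma cconj_linear: "cconj (x + y) = cconj x + cconj y" "cconj (x - y) = cconj x - cconj y"
    "cconj (r *\<^sub>R x) = r *\<^sub>R cconj x" "cconj (- x) = - cconj x"
  by (simp_all add: vec_eq_iff cconj_def)

lemma cconj_eq_iff [simp]: "cconj x = cconj y \<longleftrightarrow> x = y"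
  by (metis cconj_cconj)

lemma cconj_eq_0_iff: "cconj x = 0 \<longleftrightarrow> x = 0"
  by (metis cconj_cconj cconj_zero)

lemma cconj_creal [simp]: "cconj (creal r) = creal r"
  by (simp add: vec_eq_iff cconj_def creal_def axis_def)

lemma cconj_cmul: "cconj (x \<odot> y) = cconj y \<odot> cconj x"
  by (simp add: vec_eq_iff forall_8 cmul_nth cconj_def algebra_simps)

lemma inner_cconj: "cconj x \<bullet> cconj y = x \<bullet> y"
  by (simp add: inner_vec_def sum_8 cconj_def)

lemma norm_cconj [simp]: "norm (cconj x) = norm x"
  by (simp add: norm_eq_sqrt_inner inner_cconj)

lemma cmul_cconj_cancel: "a \<odot> (cconj a \<odot> y) = (a \<bullet> a) *\<^sub>R y"
  by (simp add: vec_eq_iff forall_8 cmul_nth cconj_def inner_vec_def sum_8 algebra_simps)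

lemma cconj_cmul_cancel: "cconj a \<odot> (a \<odot> y) = (a \<bullet> a) *\<^sub>R y"
  using cmul_cconj_cancel[of "cconj a"] by (simp add: inner_cconj)

text \<open>Polarization of \<open>cmul_cconj_cancel\<close>: substitute \<open>a + cconj x\<close>
  for \<open>a\<close> and keep the mixed terms.\<close>

lemma cmul_cconj_polar: "cconj x \<odot> (cconj a \<odot> y) + a \<odot> (x \<odot> y) = (2 * (a \<bullet> cconj x)) *\<^sub>R y"
proof -
  have "(a + cconj x) \<odot> (cconj (a + cconj x) \<odot> y) = a \<odot> (cconj a \<odot> y) + cconj x \<odot> (x \<odot> y)
      + (cconj x \<odot> (cconj a \<odot> y) + a \<odot> (x \<odot> y))"
    by (simp add: cmul_add cconj_linear)
  moreover have "cconj x \<odot> (x \<odot> y) = (cconj x \<bullet> cconj x) *\<^sub>R y"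
    using cmul_cconj_cancel[of "cconj x" y] by simp
  ultimately have "cconj x \<odot> (cconj a \<odot> y) + a \<odot> (x \<odot> y)
      = ((a + cconj x) \<bullet> (a + cconj x)) *\<^sub>R y - (a \<bullet> a) *\<^sub>R y - (cconj x \<bullet> cconj x) *\<^sub>R y"
    by (simp add: cmul_cconj_cancel)
  also have "\<dots> = (2 * (a \<bullet> cconj x)) *\<^sub>R y"
    by (simp add: inner_add inner_commute flip: scaleR_left_diff_distrib)
  finally show ?thesis .
qed

text \<open>Both sides are values of the trilinear form: Re ((x y) z) and Re ((y z) x).\<close>

lemma inner_cconj_cmul_cyclic: "cconj (x \<odot> y) \<bullet> z = cconj (y \<odot> z) \<bullet> x"
  by (simp add: inner_vec_def sum_8 cmul_nth cconj_def algebra_simps)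

lemma cmul_cconj_symmetric: "x \<odot> cconj y + y \<odot> cconj x = creal (2 * (x \<bullet> y))"
  by (simp add: vec_eq_iff forall_8 cmul_nth cconj_def creal_def axis_def inner_vec_def sum_8 algebra_simps)

section \<open>Triality and determinants\<close>

text \<open>When the reflection is expanded, its denominator \<open>a \<bullet> a\<close> cancels
  because \<open>a \<odot> (cconj a \<odot> z)\<close> is
  \<open>(a \<bullet> a) *\<^sub>R z\<close>; the rest is \<open>cmul_cconj_polar\<close>.\<close>

lemma reflection_cconj_cmul:
  assumes "a \<noteq> 0"
  shows "reflection a (cconj w) \<odot> (cconj a \<odot> z) = - (a \<odot> (w \<odot> z))"
proof -
  have "reflection a (cconj w) \<odot> (cconj a \<odot> z) = cconj w \<odot> (cconj a \<odot> z) - (2 * (a \<bullet> cconj w)) *\<^sub>R z"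
    using assms by (simp add: reflection_def cmul_diff_left cmul_scaleR cmul_cconj_cancel)
  then show ?thesis
    using cmul_cconj_polar[of w a z] by (metis add_diff_cancel_left' minus_diff_eq)
qed

text \<open>The partners are only linear and injective, not orthogonal, because the reflection step
  multiplies them by \<open>a\<close> or \<open>cconj a\<close>, whose norm is arbitrary.\<close>

definition triality_left :: "(cayley \<Rightarrow> cayley) \<Rightarrow> bool" where
  "triality_left f \<longleftrightarrow> (\<exists>p q. linear p \<and> linear q \<and> inj p \<and> inj q \<and> (\<forall>x y. f x \<odot> p y = q (x \<odot> y)))"

lemma triality_left_id: "triality_left (\<lambda>x. x)"
  unfolding triality_left_def by (intro exI[of _ "\<lambda>x. x"]) (simp add: linear_iff)

text \<open>In \<open>reflection_cconj_cmul\<close> take \<open>w\<close> to be the conjugate of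
  \<open>f (cconj x)\<close> and \<open>z = q u\<close>; \<open>swap\<close> then evaluates
  \<open>w \<odot> z\<close>. The partners exchange roles: \<open>q\<close> yields the new
  \<open>p'\<close>, and \<open>p\<close> the new \<open>q'\<close>.\<close>

lemma triality_left_reflection:
  assumes a: "a \<noteq> 0" and nf: "\<And>x. norm (f x) = norm x" and f: "triality_left f"
  shows "triality_left (\<lambda>x. reflection a (f (cconj x)))"
proof -
  obtain p q where p: "linear p" "inj p" and q: "linear q" "inj q" and pq: "\<And>x y. f x \<odot> p y = q (x \<odot> y)"
    using f unfolding triality_left_def by blast
  \<comment> \<open>Put \<open>y = cconj x \<odot> u\<close> in \<open>pq\<close> and multiply by
    \<open>cconj (f x)\<close> on the left. Since \<open>f\<close> preserves norms, both sides
    acquire the factor \<open>x \<bullet> x\<close>, which cancels for nonzero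
    \<open>x\<close>.\<close>
  have swap: "cconj (f x) \<odot> q u = p (cconj x \<odot> u)" for x u
  proof (cases "x = 0")
    case True
    then have "f x = 0" using nf[of x] by simp
    then show ?thesis using True linear_0[OF p(1)] by simp
  next
    case False
    have "(x \<bullet> x) *\<^sub>R (cconj (f x) \<odot> q u) = cconj (f x) \<odot> q (x \<odot> (cconj x \<odot> u))"
      by (simp add: cmul_cconj_cancel linear_cmul[OF q(1)] cmul_scaleR)
    also have "\<dots> = (f x \<bullet> f x) *\<^sub>R p (cconj x \<odot> u)"
      by (simp flip: pq add: cconj_cmul_cancel)
    also have "f x \<bullet> f x = x \<bullet> x"
      by (simp add: dot_square_norm nf)
    finally show ?thesis using False by simp
  qed
  define p' where "p' = (\<lambda>u. cconj a \<odot> q u)"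
  define q' where "q' = (\<lambda>u. - (a \<odot> p u))"
  have lin: "linear p'" "linear q'"
    using p q by (auto simp: p'_def q'_def linear_iff cmul_add cmul_scaleR)
  have "inj p'"
    using a q lin(1) by (auto simp: linear_injective_0 p'_def cmul_eq_0_iff cconj_eq_0_iff)
  moreover have "inj q'"
    using a p lin(2) by (auto simp: linear_injective_0 q'_def cmul_eq_0_iff)
  moreover have "reflection a (f (cconj x)) \<odot> p' u = q' (x \<odot> u)" for x u
    using reflection_cconj_cmul[OF a, of "cconj (f (cconj x))" "q u"] swap[of "cconj x" u]
    by (simp add: p'_def q'_def)
  ultimately show ?thesis
    unfolding triality_left_def using lin by blast
qed

text \<open>Take \<open>x\<close> to be the unit e_1 and \<open>y\<close> the unit e_i. On the
  associative quaternion subalgebra spanned by 1, e_1, e_i and e_1 e_i the two products differ by a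
  sign, so those coordinates of \<open>a\<close> vanish. The choices i = 2, 3, 5 cover all eight
  coordinates.\<close>

lemma cmul_commutator_vanish:
  assumes "\<And>x y. x \<odot> (y \<odot> a) = (y \<odot> x) \<odot> a"
  shows "a = 0"
proof -
  have "axis 1 1 \<odot> (axis i 1 \<odot> a) = (axis i 1 \<odot> axis 1 1) \<odot> a" for i
    by (rule assms)
  from this[of 2] this[of 3] this[of 5]
  show ?thesis
    unfolding vec_eq_iff forall_8 by (auto simp: cmul_nth axis_def)
qed

text \<open>
  If \<open>f\<close> and \<open>f \<circ> cconj\<close> both were left components, then so would be \<open>cconj\<close>, and the products of
  \<open>x\<close> and \<open>y\<close> in the two orders would act in the same way on some nonzero \<open>a\<close>.
\<close>

lemma not_triality_left_both:
  assumes "triality_left f" "triality_left (\<lambda>x. f (cconj x))"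
  shows False
proof -
  obtain p q where p: "linear p" "inj p" and q: "linear q" "inj q" and pq: "\<And>x y. f x \<odot> p y = q (x \<odot> y)"
    using assms(1) unfolding triality_left_def by blast
  obtain p' q' where p': "linear p'" "inj p'" and pq': "\<And>x y. f (cconj x) \<odot> p' y = q' (x \<odot> y)"
    using assms(2) unfolding triality_left_def by blast
  have "surj p"
    using p linear_injective_imp_surjective by blast
  define g where "g y = inv_into UNIV p (p' y)" for y
  have g: "p (g y) = p' y" for y
    using \<open>surj p\<close> by (simp add: g_def surj_f_inv_f)
  have eq: "q (cconj x \<odot> g y) = q' (x \<odot> y)" for x y
    using pq[of "cconj x" "g y"] pq'[of x y] g[of y] by simp
  \<comment> \<open>Comparing with the case where the first argument is 1 eliminates
    \<open>q'\<close>; injectivity of \<open>q\<close> then exhibits \<open>cconj\<close> as a left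
    component with both partners equal to \<open>g\<close>.\<close>
  have "q (g (x \<odot> y)) = q (cconj x \<odot> g y)" for x y
    using eq[of "creal 1" "x \<odot> y"] eq[of x y] by (simp add: cmul_one)
  then have "g (x \<odot> y) = cconj x \<odot> g y" for x y
    by (rule injD[OF q(2)])
  \<comment> \<open>Evaluate \<open>g (x \<odot> y)\<close> twice, reading its argument as (x y) 1
    and as x (y 1).\<close>
  then have "(cconj y \<odot> cconj x) \<odot> g (creal 1) = cconj x \<odot> (cconj y \<odot> g (creal 1))" for x y
    using cmul_one(2)[of "x \<odot> y"] by (metis cconj_cmul cmul_one(2))
  then have "g (creal 1) = 0"
    by (intro cmul_commutator_vanish) (metis cconj_cconj)
  then have "p' (creal 1) = 0"
    using g[of "creal 1"] linear_0[OF p(1)] by simp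
  then have "creal 1 = 0"
    using p' linear_0 by (metis inj_eq)
  then show False
    by (simp add: creal_def)
qed

lemma det_triality_left:
  assumes f: "orthogonal_transformation f" and "triality_left f"
  shows "det (matrix f) = 1"
proof -
  \<comment> \<open>The dichotomy is proved for every orthogonal map, since partial products of
    reflections need not be left components. Each reflection flips the sign and inserts one
    \<open>cconj\<close>; two of these cancel.\<close>
  have "det (matrix f) = 1 \<and> triality_left f \<or> det (matrix f) = -1 \<and> triality_left (\<lambda>x. f (cconj x))"
    using f
  proof (induction rule: orthogonal_transformation_induct)
    case id
    then show ?case
      by (simp add: triality_left_id matrix_id_mat_1[unfolded id_def])
  next
    case (reflection a f)
    have "det (matrix (\<lambda>x. reflection a (f x))) = det (matrix (reflection a)) * det (matrix f)"
      using matrix_compose[of f "reflection a"] orthogonal_transformation_linear[OF reflection(2)]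
        orthogonal_transformation_linear[OF orthogonal_transformation_reflection, of a]
      by (simp add: o_def det_mul)
    then have "det (matrix (\<lambda>x. reflection a (f x))) = - det (matrix f)"
      using det_reflection[OF reflection(1)] by simp
    moreover have "norm (f x) = norm x" for x
      using reflection(2) by (rule orthogonal_transformation_norm)
    ultimately show ?case
      using reflection(3) triality_left_reflection[OF reflection(1), of f]
        triality_left_reflection[OF reflection(1), of "\<lambda>x. f (cconj x)"] by auto
  qed
  then show ?thesis
    using not_triality_left_both assms(2) by blast
qed

section \<open>Rotation matrices in triality\<close>

definition triality :: "(cayley \<Rightarrow> cayley) \<Rightarrow> (cayley \<Rightarrow> cayley) \<Rightarrow> (cayley \<Rightarrow> cayley) \<Rightarrow> bool" where
  "triality f g h \<longleftrightarrow> (\<forall>x y. f x \<odot> g y = cconj (h (cconj (x \<odot> y))))"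

text \<open>Triality and orthogonality of \<open>h\<close> make the cyclic form Re ((x y) z)
  invariant under the triple. Orthogonality and surjectivity of \<open>f\<close> then allow the
  rotated relation to be tested against all vectors \<open>f x\<close>.\<close>

lemma triality_rotate:
  assumes f: "orthogonal_transformation f" and h: "orthogonal_transformation h" and t: "triality f g h"
  shows "triality g h f"
proof -
  have "cconj (g y \<odot> h z) = f (cconj (y \<odot> z))" for y z
  proof -
    have "cconj (g y \<odot> h z) \<bullet> f x = f (cconj (y \<odot> z)) \<bullet> f x" for x
    proof -
      have "cconj (g y \<odot> h z) \<bullet> f x = cconj (f x \<odot> g y) \<bullet> h z"
        by (rule inner_cconj_cmul_cyclic[symmetric])
      also have "\<dots> = h (cconj (x \<odot> y)) \<bullet> h z"
        using t by (simp add: triality_def)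
      also have "\<dots> = cconj (x \<odot> y) \<bullet> z"
        using h by (simp add: orthogonal_transformation_def)
      also have "\<dots> = f (cconj (y \<odot> z)) \<bullet> f x"
        using f inner_cconj_cmul_cyclic[of x y z] by (simp add: orthogonal_transformation_def)
      finally show ?thesis .
    qed
    then show ?thesis
      by (metis orthogonal_transformation_surj[OF f] surjD vector_eq_ldot inner_commute)
  qed
  then show ?thesis
    unfolding triality_def by (metis cconj_cconj)
qed

lemma triality_det:
  assumes f: "orthogonal_transformation f" and g: "orthogonal_transformation g"
    and h: "orthogonal_transformation h" and t: "triality f g h"
  shows "det (matrix f) = 1"
proof (rule det_triality_left[OF f])
  let ?q = "\<lambda>x. cconj (h (cconj x))"
  have "linear ?q"
    using orthogonal_transformation_linear[OF h] by (auto simp: linear_iff cconj_linear)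
  moreover have "inj ?q"
    using orthogonal_transformation_inj[OF h] by (intro injI) (simp add: inj_eq)
  ultimately show "triality_left f"
    using t orthogonal_transformation_linear[OF g] orthogonal_transformation_inj[OF g]
    unfolding triality_left_def triality_def by blast
qed

lemma orthogonal_matrix_imp_transformation:
  "orthogonal_matrix (A :: real ^ 'n ^ 'n) \<Longrightarrow> orthogonal_transformation ((*v) A)"
  by (simp add: orthogonal_transformation_matrix)

text \<open>\<open>triality_det\<close> concerns the first component; rotating the triple brings
  each of the others into first place.\<close>

lemma triality_rotation_matrix:
  assumes f: "orthogonal_transformation f" and g: "orthogonal_transformation g"
    and h: "orthogonal_transformation h" and t: "triality f g h"
  shows "rotation_matrix (matrix f)" "rotation_matrix (matrix g)" "rotation_matrix (matrix h)"
  using f g h triality_det[OF f g h t] triality_det[OF g h f triality_rotate[OF f h t]]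
    triality_det[OF h f g triality_rotate[OF g f triality_rotate[OF f h t]]]
  by (simp_all add: rotation_matrix_def orthogonal_transformation_matrix)

section \<open>Coordinates of the Jordan algebra\<close>

lemma jordan_cases:
  assumes "X \<in> \<JJ>"
  obtains a b c x y z where "X = jmat a b c x y z"
  using jordan_eq_jmat[OF assms] by blast

lemma creal_0 [simp]: "creal 0 = 0"
  by (simp add: creal_def)

lemma creal_nth_0 [simp]: "creal r $ 0 = r"
  by (simp add: creal_def axis_def)

lemma creal_eq_iff [simp]: "creal r = creal s \<longleftrightarrow> r = s"
  by (metis creal_nth_0)

lemma creal_add: "creal (r + s) = creal r + creal s"
  by (simp add: creal_def axis_def vec_eq_iff)

lemma creal_cmul: "creal (r * s) = r *\<^sub>R creal s"
  by (simp add: creal_def axis_def vec_eq_iff)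

lemma jmat_eq_iff:
  "jmat a b c x y z = jmat a' b' c' x' y' z' \<longleftrightarrow>
    a = a' \<and> b = b' \<and> c = c' \<and> x = x' \<and> y = y' \<and> z = z'"
  by (auto simp: vec_eq_iff[of "jmat _ _ _ _ _ _"] vec_eq_iff[of "jmat _ _ _ _ _ _ $ _"]
      forall_3 jmat_nth)

lemma jmat_add:
  "jmat a b c x y z + jmat a' b' c' x' y' z' = jmat (a + a') (b + b') (c + c') (x + x') (y + y') (z + z')"
  by (simp add: vec_eq_iff[of "jmat _ _ _ _ _ _ + _"] vec_eq_iff[of "_ $ _ + jmat _ _ _ _ _ _ $ _"]
      forall_3 jmat_nth creal_add cconj_linear)

lemma jmat_scaleR:
  "r *\<^sub>R jmat a b c x y z = jmat (r * a) (r * b) (r * c) (r *\<^sub>R x) (r *\<^sub>R y) (r *\<^sub>R z)"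
  by (simp add: vec_eq_iff[of "_ *\<^sub>R jmat _ _ _ _ _ _"] vec_eq_iff[of "_ *\<^sub>R jmat _ _ _ _ _ _ $ _"]
      forall_3 jmat_nth creal_cmul cconj_linear)

text \<open>The formula is invariant under simultaneous cyclic shifts of the diagonal and
  off-diagonal coordinates. Diagonal entries come from the polarized norm, off-diagonal ones from
  \<open>cconj\<close> reversing products.\<close>

lemma jmul_jmat:
  "jmat a b c x y z \<circ>\<^sub>J jmat a' b' c' x' y' z' =
    jmat (a * a' + y \<bullet> y' + z \<bullet> z') (b * b' + x \<bullet> x' + z \<bullet> z') (c * c' + x \<bullet> x' + y \<bullet> y')
      ((1 / 2) *\<^sub>R ((b + c) *\<^sub>R x' + (b' + c') *\<^sub>R x + cconj (y \<odot> z' + y' \<odot> z)))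
      ((1 / 2) *\<^sub>R ((c + a) *\<^sub>R y' + (c' + a') *\<^sub>R y + cconj (z \<odot> x' + z' \<odot> x)))
      ((1 / 2) *\<^sub>R ((a + b) *\<^sub>R z' + (a' + b') *\<^sub>R z + cconj (x \<odot> y' + x' \<odot> y)))"
  (is "?X \<circ>\<^sub>J ?Y = ?Z")
proof -
  have entry: "(?X \<circ>\<^sub>J ?Y) $ i $ j = (1 / 2) *\<^sub>R
      (?X $ i $ 1 \<odot> ?Y $ 1 $ j + ?X $ i $ 2 \<odot> ?Y $ 2 $ j + ?X $ i $ 3 \<odot> ?Y $ 3 $ j +
      (?Y $ i $ 1 \<odot> ?X $ 1 $ j + ?Y $ i $ 2 \<odot> ?X $ 2 $ j + ?Y $ i $ 3 \<odot> ?X $ 3 $ j))" for i j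
    by (simp add: jmul_def mmul_def sum_3)
  have halve: "(1 / 2) *\<^sub>R w = v \<longleftrightarrow> w = 2 *\<^sub>R v" for v w :: cayley
    by auto
  have diag: "x \<odot> cconj y + y \<odot> cconj x = (2 * (x \<bullet> y)) *\<^sub>R creal 1"
    "cconj x \<odot> y + cconj y \<odot> x = (2 * (x \<bullet> y)) *\<^sub>R creal 1" for x y
    using cmul_cconj_symmetric[of x y] cmul_cconj_symmetric[of "cconj x" "cconj y"]
    by (simp_all add: inner_cconj flip: creal_cmul)
  have "(?X \<circ>\<^sub>J ?Y) $ i $ j = ?Z $ i $ j" for i j
  proof -
    have "(?X \<circ>\<^sub>J ?Y) $ 1 $ 1 = ?Z $ 1 $ 1"
      unfolding entry jmat_nth halve using diag(1)[of z z'] diag(2)[of y y']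
      by (simp add: cmul_creal creal_add creal_cmul scaleR_add_right) (simp add: creal_def axis_def vec_eq_iff algebra_simps)
    moreover have "(?X \<circ>\<^sub>J ?Y) $ 2 $ 2 = ?Z $ 2 $ 2"
      unfolding entry jmat_nth halve using diag(1)[of x x'] diag(2)[of z z']
      by (simp add: cmul_creal creal_add creal_cmul scaleR_add_right) (simp add: creal_def axis_def vec_eq_iff algebra_simps)
    moreover have "(?X \<circ>\<^sub>J ?Y) $ 3 $ 3 = ?Z $ 3 $ 3"
      unfolding entry jmat_nth halve using diag(1)[of y y'] diag(2)[of x x']
      by (simp add: cmul_creal creal_add creal_cmul scaleR_add_right) (simp add: creal_def axis_def vec_eq_iff algebra_simps)
    moreover have "(?X \<circ>\<^sub>J ?Y) $ 1 $ 2 = ?Z $ 1 $ 2" "(?X \<circ>\<^sub>J ?Y) $ 1 $ 3 = ?Z $ 1 $ 3"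
      "(?X \<circ>\<^sub>J ?Y) $ 2 $ 1 = ?Z $ 2 $ 1" "(?X \<circ>\<^sub>J ?Y) $ 2 $ 3 = ?Z $ 2 $ 3"
      "(?X \<circ>\<^sub>J ?Y) $ 3 $ 1 = ?Z $ 3 $ 1" "(?X \<circ>\<^sub>J ?Y) $ 3 $ 2 = ?Z $ 3 $ 2"
      unfolding entry jmat_nth
      by (simp_all add: cmul_creal cconj_linear cconj_cmul algebra_simps)
    ultimately show ?thesis
      using exhaust_3[of i] exhaust_3[of j] by auto
  qed
  then show ?thesis
    by (simp add: vec_eq_iff)
qed

lemma sigma_jmat: "\<sigma> (jmat a b c x y z) = jmat a b c x (- y) (- z)"
  by (simp add: sigma_def jmat_in_jordan jmat_nth)

lemma sigma'_jmat: "\<sigma>' (jmat a b c x y z) = jmat a b c (- x) (- y) z"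
  by (simp add: sigma'_def jmat_in_jordan jmat_nth)

lemma involution_Bij:
  assumes "s \<in> extensional S" "\<And>x. x \<in> S \<Longrightarrow> s x \<in> S" "\<And>x. x \<in> S \<Longrightarrow> s (s x) = x"
  shows "s \<in> Bij S"
  using assms by (auto simp: Bij_def intro!: bij_betw_byWitness[where f' = s])

lemma sigma_Bij: "\<sigma> \<in> Bij \<JJ>"
proof (rule involution_Bij)
  show "\<sigma> \<in> extensional \<JJ>" by (simp add: sigma_def)
qed (auto elim!: jordan_cases simp: sigma_jmat jmat_in_jordan)

lemma sigma'_Bij: "\<sigma>' \<in> Bij \<JJ>"
proof (rule involution_Bij)
  show "\<sigma>' \<in> extensional \<JJ>" by (simp add: sigma'_def)
qed (auto elim!: jordan_cases simp: sigma'_jmat jmat_in_jordan)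

section \<open>The elements of \<open>F\<^sub>4\<close> that commute with both involutions\<close>

text \<open>As \<open>s\<close> is its own inverse on \<open>\<JJ>\<close>, invariance under
  conjugation is commutation. All maps involved are extensional, so equality can be checked
  pointwise on \<open>\<JJ>\<close>.\<close>

lemma F4_fix_iff:
  assumes s: "s \<in> Bij \<JJ>" and inv: "\<And>X. X \<in> \<JJ> \<Longrightarrow> s (s X) = X"
  shows "\<alpha> \<in> F4_fix s \<longleftrightarrow> \<alpha> \<in> carrier F4 \<and> (\<forall>X\<in>\<JJ>. \<alpha> (s X) = s (\<alpha> X))"
proof (cases "\<alpha> \<in> carrier F4")
  case True
  then have \<alpha>: "\<alpha> \<in> Bij \<JJ>"
    by (simp add: F4_def)
  have mem: "s X \<in> \<JJ>" "\<alpha> X \<in> \<JJ>" if "X \<in> \<JJ>" for X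
    using Bij_imp_funcset[OF s] Bij_imp_funcset[OF \<alpha>] that by auto
  have "s \<otimes>\<^bsub>F4\<^esub> \<alpha> \<otimes>\<^bsub>F4\<^esub> s = compose \<JJ> (compose \<JJ> s \<alpha>) s"
    using s \<alpha> by (simp add: F4_def BijGroup_def compose_Bij)
  moreover have "compose \<JJ> (compose \<JJ> s \<alpha>) s = \<alpha> \<longleftrightarrow> (\<forall>X\<in>\<JJ>. s (\<alpha> (s X)) = \<alpha> X)"
  proof
    assume eq: "compose \<JJ> (compose \<JJ> s \<alpha>) s = \<alpha>"
    show "\<forall>X\<in>\<JJ>. s (\<alpha> (s X)) = \<alpha> X"
    proof
      fix X assume "X \<in> \<JJ>"
      then show "s (\<alpha> (s X)) = \<alpha> X"
        using fun_cong[OF eq, of X] mem by (simp add: compose_eq)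
    qed
  next
    assume "\<forall>X\<in>\<JJ>. s (\<alpha> (s X)) = \<alpha> X"
    then show "compose \<JJ> (compose \<JJ> s \<alpha>) s = \<alpha>"
      by (intro extensionalityI[OF compose_extensional Bij_imp_extensional[OF \<alpha>]])
        (simp add: compose_eq mem)
  qed
  moreover have "s (\<alpha> (s X)) = \<alpha> X \<longleftrightarrow> \<alpha> (s X) = s (\<alpha> X)" if "X \<in> \<JJ>" for X
    using inv mem that by metis
  ultimately show ?thesis
    using True by (simp add: F4_fix_def)
qed (simp add: F4_fix_def)

lemma sigma_sigma: "X \<in> \<JJ> \<Longrightarrow> \<sigma> (\<sigma> X) = X"
  by (auto elim!: jordan_cases simp: sigma_jmat)

lemma sigma'_sigma': "X \<in> \<JJ> \<Longrightarrow> \<sigma>' (\<sigma>' X) = X"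
  by (auto elim!: jordan_cases simp: sigma'_jmat)

lemma F4_fix_sigma_iff:
  "\<alpha> \<in> F4_fix \<sigma> \<inter> F4_fix \<sigma>' \<longleftrightarrow>
    \<alpha> \<in> carrier F4 \<and> (\<forall>X\<in>\<JJ>. \<alpha> (\<sigma> X) = \<sigma> (\<alpha> X) \<and> \<alpha> (\<sigma>' X) = \<sigma>' (\<alpha> X))"
  using F4_fix_iff[OF sigma_Bij sigma_sigma] F4_fix_iff[OF sigma'_Bij sigma'_sigma'] by auto

section \<open>The action of triality triples on the Jordan algebra\<close>

fun spin_act :: "(real ^ 8 ^ 8) \<times> (real ^ 8 ^ 8) \<times> (real ^ 8 ^ 8) \<Rightarrow> cayley_mat3 \<Rightarrow> cayley_mat3" where
  "spin_act (A, B, C) = (\<lambda>X\<in>\<JJ>. jmat (X $ 1 $ 1 $ 0) (X $ 2 $ 2 $ 0) (X $ 3 $ 3 $ 0)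
     (A *v X $ 2 $ 3) (B *v X $ 3 $ 1) (C *v X $ 1 $ 2))"

declare spin_act.simps [simp del]

lemma spin_act_jmat: "spin_act (A, B, C) (jmat a b c x y z) = jmat a b c (A *v x) (B *v y) (C *v z)"
  by (simp add: spin_act.simps jmat_in_jordan jmat_nth)

lemma spin_act_extensional: "spin_act S \<in> extensional \<JJ>"
  by (cases S) (simp add: spin_act.simps)

lemma extensional_jordan_eqI:
  assumes "f \<in> extensional \<JJ>" "g \<in> extensional \<JJ>"
    "\<And>a b c x y z. f (jmat a b c x y z) = g (jmat a b c x y z)"
  shows "f = g"
  using assms(1,2) by (rule extensionalityI) (auto elim!: jordan_cases simp: assms(3))

lemma mem_Spin8_iff:
  "(A, B, C) \<in> carrier Spin8 \<longleftrightarrow>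
    rotation_matrix A \<and> rotation_matrix B \<and> rotation_matrix C \<and> triality ((*v) A) ((*v) B) ((*v) C)"
  by (auto simp: Spin8_def SO8_def triality_def)

lemma spin_act_compose:
  "compose \<JJ> (spin_act (A, B, C)) (spin_act (A', B', C')) = spin_act (A ** A', B ** B', C ** C')"
proof (rule extensional_jordan_eqI)
  show "compose \<JJ> (spin_act (A, B, C)) (spin_act (A', B', C')) \<in> extensional \<JJ>"
    by (rule compose_extensional)
qed (simp_all add: spin_act_extensional compose_def jmat_in_jordan spin_act_jmat matrix_vector_mul_assoc)

text \<open>In the product formula the diagonal entries are preserved because the matrices are
  isometries, and the three off-diagonal entries by triality and its two rotations.\<close>

lemma spin_act_mem:
  assumes "S \<in> carrier Spin8"
  shows "spin_act S \<in> F4_fix \<sigma> \<inter> F4_fix \<sigma>'"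
proof -
  obtain A B C where S: "S = (A, B, C)"
    by (cases S)
  have om: "orthogonal_matrix A" "orthogonal_matrix B" "orthogonal_matrix C"
    using assms by (simp_all add: S mem_Spin8_iff rotation_matrix_def)
  note ot = om[THEN orthogonal_matrix_imp_transformation]
  have t1: "triality ((*v) A) ((*v) B) ((*v) C)"
    using assms by (simp add: S mem_Spin8_iff)
  have t2: "triality ((*v) B) ((*v) C) ((*v) A)"
    using ot t1 by (blast intro: triality_rotate)
  have t3: "triality ((*v) C) ((*v) A) ((*v) B)"
    using ot t2 by (blast intro: triality_rotate)
  have inner: "(M *v x) \<bullet> (M *v y) = x \<bullet> y" if "orthogonal_transformation ((*v) M)"
    for M :: "real ^ 8 ^ 8" and x y
    using that by (simp add: orthogonal_transformation_def)
  have inverse: "M *v (transpose M *v x) = x" "transpose M *v (M *v x) = x" if "orthogonal_matrix M"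
    for M :: "real ^ 8 ^ 8" and x
    using that by (simp_all add: matrix_vector_mul_assoc orthogonal_matrix_def del: transpose_matrix_vector)
  \<comment> \<open>The inverse is the action of the transposes; orthogonality alone makes them
    inverse to each other.\<close>
  have "bij_betw (spin_act (A, B, C)) \<JJ> \<JJ>"
    by (rule bij_betw_byWitness[where f' = "spin_act (transpose A, transpose B, transpose C)"])
      (auto elim!: jordan_cases simp: spin_act_jmat jmat_in_jordan inverse om simp del: transpose_matrix_vector)
  then have "spin_act (A, B, C) \<in> Bij \<JJ>"
    by (simp add: Bij_def spin_act_extensional)
  moreover have "spin_act (A, B, C) (X + Y) = spin_act (A, B, C) X + spin_act (A, B, C) Y"
    if "X \<in> \<JJ>" "Y \<in> \<JJ>" for X Y
    using that by (auto elim!: jordan_cases simp: jmat_add spin_act_jmat matrix_vector_right_distrib)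
  moreover have "spin_act (A, B, C) (r *\<^sub>R X) = r *\<^sub>R spin_act (A, B, C) X" if "X \<in> \<JJ>" for r X
    using that by (auto elim!: jordan_cases simp: jmat_scaleR spin_act_jmat matrix_vector_mult_scaleR)
  moreover have "spin_act (A, B, C) (X \<circ>\<^sub>J Y) = spin_act (A, B, C) X \<circ>\<^sub>J spin_act (A, B, C) Y"
    if "X \<in> \<JJ>" "Y \<in> \<JJ>" for X Y
    using that t1[unfolded triality_def] t2[unfolded triality_def] t3[unfolded triality_def]
    by (auto elim!: jordan_cases simp: jmul_jmat spin_act_jmat matrix_vector_right_distrib
        matrix_vector_mult_scaleR cconj_linear inner ot)
  moreover have "spin_act (A, B, C) (\<sigma> X) = \<sigma> (spin_act (A, B, C) X)"
    "spin_act (A, B, C) (\<sigma>' X) = \<sigma>' (spin_act (A, B, C) X)" if "X \<in> \<JJ>" for X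
    using that by (auto elim!: jordan_cases simp: spin_act_jmat sigma_jmat sigma'_jmat
        linear_neg[OF matrix_vector_mul_linear])
  ultimately show ?thesis
    unfolding F4_fix_sigma_iff S by (simp add: F4_def)
qed

text \<open>Being defined on arbitrary functions by evaluation at fixed matrices, this map is
  continuous on any set. It gives a faithful record of \<alpha> only once the three components are
  known to be linear.\<close>

definition spin_coords ::
  "(cayley_mat3 \<Rightarrow> cayley_mat3) \<Rightarrow> (real ^ 8 ^ 8) \<times> (real ^ 8 ^ 8) \<times> (real ^ 8 ^ 8)" where
  "spin_coords \<alpha> =
    (matrix (\<lambda>x. \<alpha> (jmat 0 0 0 x 0 0) $ 2 $ 3),
     matrix (\<lambda>y. \<alpha> (jmat 0 0 0 0 y 0) $ 3 $ 1),
     matrix (\<lambda>z. \<alpha> (jmat 0 0 0 0 0 z) $ 1 $ 2))"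

lemma spin_coords_act: "spin_coords (spin_act S) = S"
  by (cases S) (simp add: spin_coords_def spin_act_jmat jmat_nth)

text \<open>
  The two involutions split the Jordan algebra into the diagonal matrices and the three off-diagonal
  spaces, and \<open>\<alpha>\<close> preserves each of these. The Jordan product of a diagonal matrix with an
  off-diagonal one recovers the pairwise sums of its entries, so \<open>\<alpha>\<close> fixes the diagonal; the square
  of an off-diagonal matrix shows that the components are isometries, and the product of two
  different ones gives triality.
\<close>

lemma F4_fix_spin_act:
  assumes "\<alpha> \<in> F4_fix \<sigma> \<inter> F4_fix \<sigma>'"
  shows "spin_coords \<alpha> \<in> carrier Spin8" "spin_act (spin_coords \<alpha>) = \<alpha>"
proof -
  have bij: "\<alpha> \<in> Bij \<JJ>"
    and add: "\<And>X Y. X \<in> \<JJ> \<Longrightarrow> Y \<in> \<JJ> \<Longrightarrow> \<alpha> (X + Y) = \<alpha> X + \<alpha> Y"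
    and scale: "\<And>r X. X \<in> \<JJ> \<Longrightarrow> \<alpha> (r *\<^sub>R X) = r *\<^sub>R \<alpha> X"
    and mul: "\<And>X Y. X \<in> \<JJ> \<Longrightarrow> Y \<in> \<JJ> \<Longrightarrow> \<alpha> (X \<circ>\<^sub>J Y) = \<alpha> X \<circ>\<^sub>J \<alpha> Y"
    and com: "\<And>X. X \<in> \<JJ> \<Longrightarrow> \<alpha> (\<sigma> X) = \<sigma> (\<alpha> X)" "\<And>X. X \<in> \<JJ> \<Longrightarrow> \<alpha> (\<sigma>' X) = \<sigma>' (\<alpha> X)"
    using assms unfolding F4_fix_sigma_iff by (auto simp: F4_def)
  note J = jmat_in_jordan
  have neg: "\<alpha> (jmat (- a) (- b) (- c) (- x) (- y) (- z)) = - \<alpha> (jmat a b c x y z)" for a b c x y z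
    using scale[OF J, of "-1"] by (simp add: jmat_scaleR)
  have minus_jmat: "- jmat a b c x y z = jmat (- a) (- b) (- c) (- x) (- y) (- z)" for a b c x y z
    using jmat_scaleR[of "-1"] by simp
  obtain p q r u v w where coords:
    "\<And>a b c x y z. \<alpha> (jmat a b c x y z) = jmat (p a b c x y z) (q a b c x y z) (r a b c x y z)
      (u a b c x y z) (v a b c x y z) (w a b c x y z)"
  proof -
    have mem: "\<alpha> (jmat a b c x y z) \<in> \<JJ>" for a b c x y z
      using Bij_imp_funcset[OF bij] J by auto
    show thesis
      by (rule that, rule jordan_eq_jmat, rule mem)
  qed
  have self_neg: "x = - x \<longleftrightarrow> x = 0" "2 * x = 0 \<longleftrightarrow> x = 0" for x :: cayley
    by (auto simp: vec_eq_iff)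
  note com_jmat = com[OF J, unfolded sigma_jmat sigma'_jmat coords jmat_eq_iff]
  note neg_jmat = neg[unfolded coords minus_jmat jmat_eq_iff]
  define f where "f x = \<alpha> (jmat 0 0 0 x 0 0) $ 2 $ 3" for x
  define g where "g y = \<alpha> (jmat 0 0 0 0 y 0) $ 3 $ 1" for y
  define h where "h z = \<alpha> (jmat 0 0 0 0 0 z) $ 1 $ 2" for z
  have D: "\<alpha> (jmat a b c 0 0 0) = jmat (p a b c 0 0 0) (q a b c 0 0 0) (r a b c 0 0 0) 0 0 0" for a b c
    using com_jmat[of a b c 0 0 0] by (simp add: coords jmat_eq_iff self_neg)
  \<comment> \<open>This matrix is fixed by \<open>\<sigma>\<close> and negated by
    \<open>\<sigma>'\<close>. The first sign pattern removes the second and third off-diagonal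
    entries of the image; the second, through \<open>neg_jmat\<close>, removes its diagonal. The
    next two cases use the other sign patterns.\<close>
  have F: "\<alpha> (jmat 0 0 0 x 0 0) = jmat 0 0 0 (f x) 0 0" for x
    using com_jmat[of 0 0 0 x 0 0] neg_jmat[of 0 0 0 x 0 0] by (simp add: f_def coords jmat_nth jmat_eq_iff self_neg)
  have G: "\<alpha> (jmat 0 0 0 0 y 0) = jmat 0 0 0 0 (g y) 0" for y
    using com_jmat[of 0 0 0 0 y 0] neg_jmat[of 0 0 0 0 y 0] by (simp add: g_def coords jmat_nth jmat_eq_iff self_neg)
  have H: "\<alpha> (jmat 0 0 0 0 0 z) = jmat 0 0 0 0 0 (h z)" for z
    using com_jmat[of 0 0 0 0 0 z] neg_jmat[of 0 0 0 0 0 z] by (simp add: h_def coords jmat_nth jmat_eq_iff self_neg)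
  have inj: "\<alpha> (jmat a b c x y z) = \<alpha> (jmat a' b' c' x' y' z') \<longleftrightarrow>
      jmat a b c x y z = jmat a' b' c' x' y' z'" for a b c x y z a' b' c' x' y' z'
    using bij J by (auto simp: Bij_def bij_betw_def inj_on_eq_iff)
  have linear: "linear f" "linear g" "linear h"
  proof -
    show "linear f"
      using add[OF J J, of 0 0 0 _ 0 0 0 0 0 _ 0 0] scale[OF J, of _ 0 0 0 _ 0 0]
      by (simp add: linear_iff jmat_add jmat_scaleR F jmat_eq_iff)
    show "linear g"
      using add[OF J J, of 0 0 0 0 _ 0 0 0 0 0 _ 0] scale[OF J, of _ 0 0 0 0 _ 0]
      by (simp add: linear_iff jmat_add jmat_scaleR G jmat_eq_iff)
    show "linear h"
      using add[OF J J, of 0 0 0 0 0 _ 0 0 0 0 0 _] scale[OF J, of _ 0 0 0 0 0 _]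
      by (simp add: linear_iff jmat_add jmat_scaleR H jmat_eq_iff)
  qed
  \<comment> \<open>One nonzero value of each component suffices to compare the scalar factors in
    \<open>diag\<close>; it comes from injectivity of \<alpha>.\<close>
  have nz: "f (creal 1) \<noteq> 0" "g (creal 1) \<noteq> 0" "h (creal 1) \<noteq> 0"
  proof -
    have "creal 1 \<noteq> 0" "f 0 = 0" "g 0 = 0" "h 0 = 0"
      using creal_eq_iff[of 1 0] linear by (simp_all add: linear_0)
    then show "f (creal 1) \<noteq> 0" "g (creal 1) \<noteq> 0" "h (creal 1) \<noteq> 0"
      using inj[of 0 0 0 "creal 1" 0 0 0 0 0 0 0 0] inj[of 0 0 0 0 "creal 1" 0 0 0 0 0 0 0]
        inj[of 0 0 0 0 0 "creal 1" 0 0 0 0 0 0] F[of "creal 1"] F[of 0] G[of "creal 1"] H[of "creal 1"]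
      by (auto simp: jmat_eq_iff)
  qed
  have diag: "\<alpha> (jmat a b c 0 0 0) = jmat a b c 0 0 0" for a b c
  proof -
    obtain a' b' c' where D': "\<alpha> (jmat a b c 0 0 0) = jmat a' b' c' 0 0 0"
      using D by blast
    have "b + c = b' + c'"
      using mul[OF J J, of a b c 0 0 0 0 0 0 "creal 1" 0 0] scale[OF J, of "(b + c) / 2" 0 0 0 "creal 1" 0 0] nz(1)
      by (simp add: D' F jmul_jmat jmat_scaleR jmat_eq_iff)
    moreover have "c + a = c' + a'"
      using mul[OF J J, of a b c 0 0 0 0 0 0 0 "creal 1" 0] scale[OF J, of "(c + a) / 2" 0 0 0 0 "creal 1" 0] nz(2)
      by (simp add: D' G jmul_jmat jmat_scaleR jmat_eq_iff)
    moreover have "a + b = a' + b'"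
      using mul[OF J J, of a b c 0 0 0 0 0 0 0 0 "creal 1"] scale[OF J, of "(a + b) / 2" 0 0 0 0 0 "creal 1"] nz(3)
      by (simp add: D' H jmul_jmat jmat_scaleR jmat_eq_iff)
    ultimately show ?thesis
      by (simp add: D' jmat_eq_iff)
  qed
  have \<alpha>_jmat: "\<alpha> (jmat a b c x y z) = jmat a b c (f x) (g y) (h z)" for a b c x y z
  proof -
    have "\<alpha> (jmat a b c x y z) = \<alpha> (jmat a b c 0 0 0) + \<alpha> (jmat 0 0 0 x y z)"
      "\<alpha> (jmat 0 0 0 x y z) = \<alpha> (jmat 0 0 0 x 0 0) + \<alpha> (jmat 0 0 0 0 y z)"
      "\<alpha> (jmat 0 0 0 0 y z) = \<alpha> (jmat 0 0 0 0 y 0) + \<alpha> (jmat 0 0 0 0 0 z)"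
      unfolding add[OF J J, symmetric] jmat_add by simp_all
    then show ?thesis
      by (simp add: diag F G H jmat_add)
  qed
  have zero: "f 0 = 0" "g 0 = 0" "h 0 = 0"
    using linear by (simp_all add: linear_0)
  have orth: "orthogonal_transformation f" "orthogonal_transformation g" "orthogonal_transformation h"
  proof -
    have "f x \<bullet> f x = x \<bullet> x" "g x \<bullet> g x = x \<bullet> x" "h x \<bullet> h x = x \<bullet> x" for x
      using mul[OF J J, of 0 0 0 x 0 0 0 0 0 x 0 0] mul[OF J J, of 0 0 0 0 x 0 0 0 0 0 x 0]
        mul[OF J J, of 0 0 0 0 0 x 0 0 0 0 0 x]
      unfolding \<alpha>_jmat jmul_jmat jmat_eq_iff by (simp_all add: zero)
    then show "orthogonal_transformation f" "orthogonal_transformation g" "orthogonal_transformation h"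
      by (simp_all add: orthogonal_transformation linear norm_eq_sqrt_inner)
  qed
  \<comment> \<open>The product has the single entry
    \<open>(1 / 2) *\<^sub>R cconj (x \<odot> y)\<close> in third position; linearity of
    \<open>h\<close> removes the factor.\<close>
  have "h (cconj (x \<odot> y)) = cconj (f x \<odot> g y)" for x y
    using mul[OF J J, of 0 0 0 x 0 0 0 0 0 0 y 0]
    unfolding \<alpha>_jmat jmul_jmat jmat_eq_iff by (simp add: zero linear_cmul[OF linear(3)])
  then have "triality f g h"
    by (simp add: triality_def)
  have sc: "spin_coords \<alpha> = (matrix f, matrix g, matrix h)"
    by (simp add: spin_coords_def f_def[abs_def] g_def[abs_def] h_def[abs_def])
  have works: "(*v) (matrix f) = f" "(*v) (matrix g) = g" "(*v) (matrix h) = h"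
    using linear by (auto intro!: ext matrix_works)
  show "spin_coords \<alpha> \<in> carrier Spin8"
    using triality_rotation_matrix[OF orth \<open>triality f g h\<close>] \<open>triality f g h\<close>
    by (simp add: sc mem_Spin8_iff works)
  show "spin_act (spin_coords \<alpha>) = \<alpha>"
    by (rule extensional_jordan_eqI[OF spin_act_extensional Bij_imp_extensional[OF bij]])
      (simp add: sc spin_act_jmat \<alpha>_jmat works)
qed

section \<open>Continuity in both directions and the isomorphism\<close>

lemma continuous_on_matrix_vector_mult_left:
  "continuous_on S A \<Longrightarrow> continuous_on S (\<lambda>s. A s *v x)" for A :: "'a::topological_space \<Rightarrow> real ^ 'n ^ 'm"
  unfolding matrix_vector_mult_def by (intro continuous_intros)

lemma continuous_on_cconj: "continuous_on S f \<Longrightarrow> continuous_on S (\<lambda>s. cconj (f s))"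
proof -
  assume f: "continuous_on S f"
  have "continuous_on S (\<lambda>s. if k = 0 then f s $ 0 else - f s $ k)" for k
    using f by (cases "k = 0") (simp_all add: continuous_on_component continuous_on_minus)
  then show ?thesis
    unfolding cconj_def by (intro continuous_on_vec_lambda)
qed

lemma continuous_on_jmat:
  assumes "continuous_on S f" "continuous_on S g" "continuous_on S h"
  shows "continuous_on S (\<lambda>s. jmat a b c (f s) (g s) (h s))"
proof -
  have "continuous_on S (\<lambda>s. jmat a b c (f s) (g s) (h s) $ i $ j)" for i j
    using exhaust_3[of i] exhaust_3[of j] by (auto simp: jmat_nth assms continuous_on_cconj)
  then have "continuous_on S (\<lambda>s. \<chi> i j. jmat a b c (f s) (g s) (h s) $ i $ j)"
    by (intro continuous_on_vec_lambda)
  then show ?thesis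
    by simp
qed

text \<open>In the product topology continuity is checked at each argument; outside
  \<open>\<JJ>\<close> the value is constantly \<open>undefined\<close>.\<close>

lemma continuous_on_spin_act: "continuous_on S spin_act"
proof (rule continuous_on_coordinatewise_then_product)
  fix X
  show "continuous_on S (\<lambda>s. spin_act s X)"
  proof (cases "X \<in> \<JJ>")
    case True
    then obtain a b c x y z where X: "X = jmat a b c x y z"
      by (rule jordan_cases)
    have "(\<lambda>s. spin_act s X) = (\<lambda>s. jmat a b c (fst s *v x) (fst (snd s) *v y) (snd (snd s) *v z))"
      by (auto simp: X fun_eq_iff spin_act_jmat)
    then show ?thesis
      by (simp only:) (intro continuous_on_jmat continuous_on_matrix_vector_mult_left continuous_intros)
  next
    case False
    then have "spin_act s X = undefined" for s
      by (rule extensional_arb[OF spin_act_extensional])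
    then show ?thesis by simp
  qed
qed

text \<open>Every matrix entry is a coordinate of the value of \<alpha> at one fixed matrix, and
  such evaluations are continuous.\<close>

lemma continuous_on_spin_coords: "continuous_on S spin_coords"
proof -
  have "continuous_on S (\<lambda>\<alpha>. \<alpha> X)" for X :: cayley_mat3
    by (rule continuous_on_subset[OF continuous_on_product_coordinates]) simp
  then show ?thesis
    unfolding spin_coords_def matrix_def
    by (intro continuous_on_Pair continuous_on_vec_lambda continuous_on_component)
qed

theorem theorem4p4p5:
  shows "F4\<lparr>carrier := F4_fix \<sigma> \<inter> F4_fix \<sigma>'\<rparr> \<cong>\<^sub>t Spin8"
proof -
  let ?G = "F4\<lparr>carrier := F4_fix \<sigma> \<inter> F4_fix \<sigma>'\<rparr>"
  have "spin_coords \<in> hom ?G Spin8"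
  proof (rule homI)
    fix \<alpha> \<beta>
    assume \<alpha>: "\<alpha> \<in> carrier ?G" and \<beta>: "\<beta> \<in> carrier ?G"
    obtain A B C where A: "spin_coords \<alpha> = (A, B, C)"
      by (cases "spin_coords \<alpha>")
    obtain A' B' C' where A': "spin_coords \<beta> = (A', B', C')"
      by (cases "spin_coords \<beta>")
    have "\<alpha> \<in> Bij \<JJ>" "\<beta> \<in> Bij \<JJ>"
      using \<alpha> \<beta> by (auto simp: F4_fix_def F4_def)
    then have "\<alpha> \<otimes>\<^bsub>?G\<^esub> \<beta> = compose \<JJ> \<alpha> \<beta>"
      by (simp add: F4_def BijGroup_def)
    \<comment> \<open>Both factors are rewritten as actions of their coordinate triples, so
      multiplicativity is inherited from \<open>spin_act\<close>.\<close>
    also have "\<dots> = spin_act (A ** A', B ** B', C ** C')"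
      using F4_fix_spin_act(2)[of \<alpha>] F4_fix_spin_act(2)[of \<beta>] \<alpha> \<beta> spin_act_compose[of A B C A' B' C']
      by (simp add: A A')
    finally show "spin_coords (\<alpha> \<otimes>\<^bsub>?G\<^esub> \<beta>) = spin_coords \<alpha> \<otimes>\<^bsub>Spin8\<^esub> spin_coords \<beta>"
      by (simp add: spin_coords_act A A' Spin8_def SO8_def)
  qed (simp add: F4_fix_spin_act)
  moreover have "bij_betw spin_coords (carrier ?G) (carrier Spin8)"
    by (rule bij_betw_byWitness[where f' = spin_act])
      (use F4_fix_spin_act spin_coords_act spin_act_mem in auto)
  moreover have "homeomorphic_maps (top_of_set (carrier ?G)) (top_of_set (carrier Spin8)) spin_coords spin_act"
    unfolding homeomorphic_maps_def
    using F4_fix_spin_act spin_coords_act spin_act_mem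
    by (auto simp: continuous_on_spin_act continuous_on_spin_coords)
  ultimately show ?thesis
    unfolding topgroup_iso_def iso_def by (blast intro: homeomorphic_maps_imp_map)
qed

end
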